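(* For every integer $k\ge 2$, the energy of the wine glass cycle $W\!gc_k$ equals $$\mathcal{E}(W\!gc_k)=2k-2\sum_{j=0}^{k-1}\alpha\!\left(2\cos\frac{2j\pi}{k}\right)-2\sum_{j=0}^{k-1}\beta\!\left(2\cos\frac{2j\pi}{k}\right).$$
   Context: The energy $\mathcal{E}(G)$ of a graph $G$ is the sum of the absolute values of the eigenvalues of its adjacency matrix. For $k\ge2$, the wine glass cycle $W\!gc_k$ is the graph with $5k$ vertices $p_j,q_j,r_j,s_j,t_j$ ($0\le j\le k-1$), and edges $p_jq_j$, $q_jp_{j+1}$, $q_jr_j$, $r_js_j$, $r_jt_j$, $s_jt_j$ for $0\le j\le k-1$, where indices are taken modulo $k$ (so $p_k=p_0$, i.e. $q_{k-1}$ is adjacent to $p_0$). Let $\mathcal{F}(x)=x^2-3-\frac{2}{(x+1)(x-2)}$ for $x\in\mathbb{R}\setminus\{-1,2\}$. For each $y\in[-2,2]$ the equation $\mathcal{F}(x)=y$ has exactly four distinct real solutions, one in each of $(-\infty,-1)$, $(-1,0]$, $(0,2)$, $(2,+\infty)$; the ones in $(-\infty,-1)$ and $(-1,0]$ are denoted $\alpha(y)$ and $\beta(y)$ respectively. *)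

theory Defs
  imports Complex_Main "Jordan_Normal_Form.Char_Poly" "Graph_Theory.Digraph_Component"
begin

definition adjacency_matrix ::
    "'v list \<Rightarrow> 'v pair_pre_digraph \<Rightarrow> 'a :: zero_neq_one mat" where
  "adjacency_matrix vs G =
     mat (length vs) (length vs) (\<lambda>(i, j). if (vs ! i, vs ! j) \<in> parcs G then 1 else 0)"

text \<open>Sum of the absolute values of the eigenvalues, each counted with its algebraic
  multiplicity. The eigenvalues are taken over the complex numbers, so none can be missed.\<close>

definition matrix_energy :: "complex mat \<Rightarrow> real" where
  "matrix_energy A = (\<Sum>x | eigenvalue A x. real (order x (char_poly A)) * cmod x)"

text \<open>A simple graph is a symmetric loop-free digraph (\<^locale>\<open>pair_graph\<close>). The adjacency matrix
  depends on an enumeration of the vertices, but its spectrum does not: two enumerations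
  give matrices that are conjugate by a permutation matrix. Any enumeration may be chosen.\<close>

definition graph_energy :: "'v pair_pre_digraph \<Rightarrow> real" where
  "graph_energy G =
     matrix_energy (adjacency_matrix (SOME vs. distinct vs \<and> set vs = pverts G) G)"

datatype wg_vertex = Vp nat | Vq nat | Vr nat | Vs nat | Vt nat

definition wine_glass_cycle :: "nat \<Rightarrow> wg_vertex pair_pre_digraph" where
  "wine_glass_cycle k = mk_symmetric
     \<lparr> pverts = (\<Union>j<k. {Vp j, Vq j, Vr j, Vs j, Vt j}),
       parcs = (\<Union>j<k. {(Vp j, Vq j), (Vq j, Vp ((j + 1) mod k)), (Vq j, Vr j),
                         (Vr j, Vs j), (Vr j, Vt j), (Vs j, Vt j)}) \<rparr>"

lemma pair_graph_wine_glass_cycle: "pair_graph (wine_glass_cycle k)"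
proof
  show "symmetric (with_proj (wine_glass_cycle k))"
    unfolding wine_glass_cycle_def by (rule symmetric_mk_symmetric)
qed (auto simp: wine_glass_cycle_def mk_symmetric_def)

definition wg_F :: "real \<Rightarrow> real" where
  "wg_F x = x\<^sup>2 - 3 - 2 / ((x + 1) * (x - 2))"

text \<open>For \<open>-2 \<le> y \<le> 2\<close> the equation \<open>wg_F x = y\<close> has exactly one solution in each of the
  two intervals below; outside that range of \<open>y\<close> the values are not meaningful.\<close>

definition wg_alpha :: "real \<Rightarrow> real" where
  "wg_alpha y = (THE x. x \<in> {..<-1} \<and> wg_F x = y)"

definition wg_beta :: "real \<Rightarrow> real" where
  "wg_beta y = (THE x. x \<in> {-1<..0} \<and> wg_F x = y)"

end

theory Submission
  imports Defs "Jordan_Normal_Form.Jordan_Normal_Form"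
begin

text \<open>
  The graph is invariant under the rotation of order \<open>k\<close>, so eigenvectors may be sought among the
  vectors whose value at \<open>v\<^sub>l\<close> is \<open>w\<^sup>l\<close> times the value at \<open>v\<^sub>0\<close>, for a root of unity \<open>w\<close>. For
  \<open>w = exp (2 \<pi> i j / k)\<close> and \<open>y = 2 Re w\<close>, eliminating the entries at \<open>p, r, s, t\<close> gives the
  eigenvalue \<open>-1\<close> together with the four roots of the quartic \<open>(x\<^sup>2 - 3 - y) (x + 1) (x - 2) - 2\<close>.
  The resulting \<open>5 k\<close> eigenvectors are orthogonal: for equal \<open>w\<close> because the eigenvalues
  differ, for different \<open>w\<close> by a geometric sum. Hence they diagonalise the adjacency matrix. The
  quartic has two roots \<open>\<alpha> < \<beta> \<le> 0\<close> and two positive ones, and all four sum to \<open>1\<close>, so the absolute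
  values of the five eigenvalues sum to \<open>2 - 2 \<alpha> - 2 \<beta>\<close>.
\<close>

section \<open>Energy of a diagonalisable matrix\<close>

text \<open>The order of a root is the number of its occurrences in \<open>as\<close>, so weighting
  the distinct eigenvalues by order regroups the sum over the list.\<close>

lemma matrix_energy_char_poly:
  assumes A: "A \<in> carrier_mat n n"
    and cp: "char_poly A = (\<Prod>a\<leftarrow>as. [:- a, 1:])"
  shows "matrix_energy A = (\<Sum>a\<leftarrow>as. cmod a)"
proof -
  have ev: "{x. eigenvalue A x} = set as"
    unfolding eigenvalue_root_char_poly[OF A] cp
    by (auto simp: poly_prod_list prod_list_zero_iff)
  have ord: "order x (char_poly A) = count_list as x" for x
    unfolding cp
    by (subst order_prod_list, force)
       (induction as, auto simp: order_linear')
  \<comment> \<open>The index set is any finite \<open>S\<close> containing the list, so that it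
    stays fixed while the list grows in the induction.\<close>
  have "(\<Sum>x\<in>S. real (count_list as x) * cmod x) = (\<Sum>a\<leftarrow>as. cmod a)"
    if "finite S" "set as \<subseteq> S" for S
    using that
  proof (induction as)
    case (Cons a as)
    have "(\<Sum>x\<in>S. real (count_list (a # as) x) * cmod x)
        = (\<Sum>x\<in>S. real (count_list as x) * cmod x + (if a = x then cmod x else 0))"
      by (intro sum.cong) (auto simp: algebra_simps)
    also have "\<dots> = (\<Sum>a\<leftarrow>a # as. cmod a)"
      using Cons by (simp add: sum.distrib)
    finally show ?case .
  qed simp
  thus ?thesis unfolding matrix_energy_def ev ord by simp
qed

lemma matrix_energy_diagonalizable:
  assumes A: "A \<in> carrier_mat n n" and P: "P \<in> carrier_mat n n" and Q: "Q \<in> carrier_mat n n"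
    and QP: "Q * P = 1\<^sub>m n"
    and AP: "A * P = P * mat_diag n d"
  shows "matrix_energy A = (\<Sum>i<n. cmod (d i))"
proof -
  let ?D = "mat_diag n d"
  have D: "?D \<in> carrier_mat n n" by simp
  have PQ: "P * Q = 1\<^sub>m n"
    by (rule mat_mult_left_right_inverse[OF Q P QP])
  have "A = A * (P * Q)" using A PQ by simp
  also have "\<dots> = P * ?D * Q" using A P Q AP by (metis assoc_mult_mat)
  finally have "similar_mat A ?D"
    using A P Q D PQ QP
    by (intro similar_matI[of _ _ P Q n]) (simp_all only: insert_subset empty_subsetI simp_thms)
  hence "char_poly A = char_poly ?D" by (rule char_poly_similar)
  also have "\<dots> = (\<Prod>a\<leftarrow>diag_mat ?D. [:- a, 1:])"
    by (rule char_poly_upper_triangular[OF D]) (auto simp: upper_triangular_def mat_diag_def)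
  also have "diag_mat ?D = map d [0..<n]"
    by (auto simp: diag_mat_def mat_diag_def)
  finally have "matrix_energy A = (\<Sum>a\<leftarrow>map d [0..<n]. cmod a)"
    by (rule matrix_energy_char_poly[OF A])
  thus ?thesis by (simp add: interv_sum_list_conv_sum_set_nat o_def atLeast0LessThan)
qed

section \<open>Graph energy from an orthogonal eigenbasis\<close>

lemma sum_nth_distinct:
  assumes "distinct vs"
  shows "(\<Sum>i<length vs. h (vs ! i)) = sum h (set vs)"
  using sum.reindex_bij_betw[OF bij_betw_nth[OF assms refl refl], of h] by simp

text \<open>Eigenvectors of a real symmetric matrix for different real eigenvalues are orthogonal,
  so \<open>orth\<close> only concerns equal ones. Nonzero orthogonal vectors, as many as there are
  vertices, form a basis.\<close>

lemma graph_energy_eigenbasis: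
  fixes G :: "'v pair_pre_digraph" and I :: "'i set"
    and f :: "'i \<Rightarrow> 'v \<Rightarrow> complex" and lam :: "'i \<Rightarrow> real"
  assumes G: "pair_graph G" and I: "finite I" "card I = card (pverts G)"
    and eigen: "\<And>c x. c \<in> I \<Longrightarrow> x \<in> pverts G \<Longrightarrow>
      (\<Sum>y | (x, y) \<in> parcs G. f c y) = of_real (lam c) * f c x"
    and nz: "\<And>c. c \<in> I \<Longrightarrow> \<exists>x\<in>pverts G. f c x \<noteq> 0"
    and orth: "\<And>c d. c \<in> I \<Longrightarrow> d \<in> I \<Longrightarrow> c \<noteq> d \<Longrightarrow> lam c = lam d \<Longrightarrow>
      (\<Sum>x\<in>pverts G. cnj (f c x) * f d x) = 0"
  shows "graph_energy G = (\<Sum>c\<in>I. \<bar>lam c\<bar>)"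
proof -
  interpret pair_graph G by (rule G)
  let ?V = "pverts G"
  define a :: "'v \<Rightarrow> 'v \<Rightarrow> complex" where "a x y = (if (x, y) \<in> parcs G then 1 else 0)" for x y
  have a_sym: "a x y = a y x" for x y
    using arcs_symmetric unfolding a_def by auto
  have eig: "(\<Sum>y\<in>?V. a x y * f c y) = of_real (lam c) * f c x" if "c \<in> I" "x \<in> ?V" for c x
  proof -
    have "(\<Sum>y\<in>?V. a x y * f c y) = (\<Sum>y\<in>?V. if (x, y) \<in> parcs G then f c y else 0)"
      by (intro sum.cong) (auto simp: a_def)
    also have "\<dots> = (\<Sum>y | y \<in> ?V \<and> (x, y) \<in> parcs G. f c y)"
      by (simp add: sum.inter_filter)
    also have "{y. y \<in> ?V \<and> (x, y) \<in> parcs G} = {y. (x, y) \<in> parcs G}"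
      by (auto intro: in_arcsD2)
    finally show ?thesis using eigen[OF that] by simp
  qed
  define ip where "ip c d = (\<Sum>x\<in>?V. cnj (f c x) * f d x)" for c d
  have ip0: "ip c d = 0" if "c \<in> I" "d \<in> I" "c \<noteq> d" for c d
  proof (cases "lam c = lam d")
    case True
    then show ?thesis using orth[OF that] by (simp add: ip_def)
  next
    case False
    \<comment> \<open>Symmetry of \<open>a\<close> moves the matrix from one argument of the inner
      product to the other; reality of \<open>lam c\<close> lets it pass through
      \<open>cnj\<close>.\<close>
    have "of_real (lam c) * ip c d = (\<Sum>x\<in>?V. cnj (of_real (lam c) * f c x) * f d x)"
      by (simp add: ip_def sum_distrib_left mult.assoc)
    also have "\<dots> = (\<Sum>x\<in>?V. \<Sum>y\<in>?V. a x y * cnj (f c y) * f d x)"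
      by (intro sum.cong refl) (auto simp: eig[OF that(1), symmetric] sum_distrib_right a_def
          intro!: sum.cong)
    also have "\<dots> = (\<Sum>y\<in>?V. \<Sum>x\<in>?V. a x y * cnj (f c y) * f d x)"
      by (rule sum.swap)
    also have "\<dots> = (\<Sum>y\<in>?V. cnj (f c y) * (\<Sum>x\<in>?V. a y x * f d x))"
      by (intro sum.cong refl) (simp add: sum_distrib_left a_sym mult_ac)
    also have "\<dots> = of_real (lam d) * ip c d"
      by (simp add: eig[OF that(2)] ip_def sum_distrib_left mult_ac)
    finally show ?thesis using False by simp
  qed
  have ipn: "ip c c \<noteq> 0" if c: "c \<in> I" for c
  proof -
    obtain x where x: "x \<in> ?V" "f c x \<noteq> 0" using nz[OF c] by blast
    have "ip c c = of_real (\<Sum>x\<in>?V. (cmod (f c x))\<^sup>2)"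
      by (simp add: ip_def complex_norm_square mult.commute del: of_real_power)
    moreover have "(\<Sum>x\<in>?V. (cmod (f c x))\<^sup>2) > 0"
      using x by (intro sum_pos2[of _ x]) auto
    ultimately show ?thesis by (metis less_irrefl of_real_eq_0_iff)
  qed
  define vs where "vs = (SOME vs. distinct vs \<and> set vs = ?V)"
  have vs: "distinct vs" "set vs = ?V"
    using someI_ex[of "\<lambda>vs. distinct vs \<and> set vs = ?V"] finite_distinct_list[of ?V]
    by (auto simp: vs_def)
  obtain cs where cs: "distinct cs" "set cs = I"
    using finite_distinct_list[OF I(1)] by blast
  define n where "n = length vs"
  have n: "length vs = n" "length cs = n"
    using distinct_card[OF vs(1)] distinct_card[OF cs(1)] vs cs I by (auto simp: n_def)
  have sum_vs: "(\<Sum>i = 0..<n. h (vs ! i)) = (\<Sum>x\<in>?V. h x)" for h :: "'v \<Rightarrow> complex"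
    using sum_nth_distinct[OF vs(1), of h] by (simp add: vs n atLeast0LessThan)
  have csI: "cs ! i \<in> I" if "i < n" for i using cs n that by auto
  have vsV: "vs ! i \<in> ?V" if "i < n" for i using vs n that by auto
  define A :: "complex mat" where "A = adjacency_matrix vs G"
  define P where "P = mat n n (\<lambda>(i, c). f (cs ! c) (vs ! i))"
  \<comment> \<open>By orthogonality, the conjugate transpose of \<open>P\<close> inverts it once
    each row is divided by the squared norm.\<close>
  define Q where "Q = mat n n (\<lambda>(c, i). cnj (f (cs ! c) (vs ! i)) / ip (cs ! c) (cs ! c))"
  define d where "d c = complex_of_real (lam (cs ! c))" for c
  have A_alt: "A = mat n n (\<lambda>(i, j). a (vs ! i) (vs ! j))"
    unfolding A_def adjacency_matrix_def a_def n ..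
  have carr: "A \<in> carrier_mat n n" "P \<in> carrier_mat n n" "Q \<in> carrier_mat n n"
    by (auto simp: A_alt P_def Q_def)
  have QP: "Q * P = 1\<^sub>m n"
  proof (rule eq_matI)
    fix c e assume "c < dim_row (1\<^sub>m n :: complex mat)" "e < dim_col (1\<^sub>m n :: complex mat)"
    hence ce: "c < n" "e < n" by auto
    have "(Q * P) $$ (c, e) = (\<Sum>i = 0..<n. cnj (f (cs ! c) (vs ! i)) / ip (cs ! c) (cs ! c)
                                   * f (cs ! e) (vs ! i))"
      using ce by (simp add: Q_def P_def scalar_prod_def)
    also have "\<dots> = ip (cs ! c) (cs ! e) / ip (cs ! c) (cs ! c)"
      by (subst sum_vs) (simp add: ip_def[of "cs ! c" "cs ! e"] sum_divide_distrib)
    also have "\<dots> = 1\<^sub>m n $$ (c, e)"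
      using ce ip0[OF csI csI, of c e] ipn[OF csI, of c] cs n
      by (auto simp: nth_eq_iff_index_eq)
    finally show "(Q * P) $$ (c, e) = 1\<^sub>m n $$ (c, e)" .
  qed (use carr in auto)
  have AP: "A * P = P * mat_diag n d"
  proof (rule eq_matI)
    fix i c assume "i < dim_row (P * mat_diag n d)" "c < dim_col (P * mat_diag n d)"
    hence ic: "i < n" "c < n" by (auto simp: P_def mat_diag_def)
    have "(A * P) $$ (i, c) = (\<Sum>j = 0..<n. a (vs ! i) (vs ! j) * f (cs ! c) (vs ! j))"
      using ic by (simp add: A_alt P_def scalar_prod_def)
    also have "\<dots> = d c * f (cs ! c) (vs ! i)"
      using ic by (subst sum_vs) (simp add: eig csI vsV d_def)
    also have "\<dots> = (P * mat_diag n d) $$ (i, c)"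
      using ic by (simp add: mat_diag_mult_right[OF carr(2)]) (simp add: P_def)
    finally show "(A * P) $$ (i, c) = (P * mat_diag n d) $$ (i, c)" .
  qed (use carr in \<open>auto simp: mat_diag_def\<close>)
  have "graph_energy G = (\<Sum>i<n. cmod (d i))"
    unfolding graph_energy_def vs_def[symmetric] A_def[symmetric]
    by (rule matrix_energy_diagonalizable[OF carr QP AP])
  also have "\<dots> = (\<Sum>c\<in>I. \<bar>lam c\<bar>)"
    using sum_nth_distinct[OF cs(1), of "\<lambda>c. \<bar>lam c\<bar>"] by (simp add: d_def n cs)
  finally show ?thesis .
qed

section \<open>The quartic and its four real roots\<close>

text \<open>This is \<open>wg_F x = y\<close> with the denominator cleared. The values at -1 and 2
  are -2, so neither pole of \<open>wg_F\<close> becomes a root.\<close>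

definition wg_quartic :: "real \<Rightarrow> real \<Rightarrow> real" where
  "wg_quartic y x = (x\<^sup>2 - 3 - y) * ((x + 1) * (x - 2)) - 2"

lemma wg_F_eq_iff:
  assumes "x \<noteq> -1" "x \<noteq> 2"
  shows "wg_F x = y \<longleftrightarrow> wg_quartic y x = 0"
proof -
  have "(x + 1) * (x - 2) \<noteq> 0" using assms by auto
  hence "x\<^sup>2 - 3 - y = 2 / ((x + 1) * (x - 2)) \<longleftrightarrow> wg_quartic y x = 0"
    unfolding wg_quartic_def by (simp only: eq_divide_eq) auto
  thus ?thesis unfolding wg_F_def by auto
qed

text \<open>Vieta's formula by divided differences: \<open>h\<close> and \<open>h2\<close> are the
  first and second ones of the quartic, the third is \<open>u + v + w + z - 1\<close>, and all
  vanish at distinct roots.\<close>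

lemma wg_quartic_roots_sum:
  assumes "wg_quartic y a = 0" "wg_quartic y b = 0" "wg_quartic y c = 0" "wg_quartic y d = 0"
    and "distinct [a, b, c, d]"
  shows "a + b + c + d = 1"
proof -
  define h where "h u v = u^3 + u\<^sup>2 * v + u * v\<^sup>2 + v^3 - (u\<^sup>2 + u * v + v\<^sup>2) - (5 + y) * (u + v) + (3 + y)"
    for u v :: real
  define h2 where "h2 u v w = u\<^sup>2 + v\<^sup>2 + w\<^sup>2 + u * v + u * w + v * w - (u + v + w) - (5 + y)" for u v w :: real
  have h: "wg_quartic y u - wg_quartic y v = (u - v) * h u v" for u v
    by (simp add: wg_quartic_def h_def algebra_simps power2_eq_square power3_eq_cube)
  have h2: "h u v - h u w = (v - w) * h2 u v w" for u v w
    by (simp add: h2_def h_def algebra_simps power2_eq_square power3_eq_cube)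
  have h3: "h2 u v w - h2 u v z = (w - z) * (u + v + w + z - 1)" for u v w z
    by (simp add: h2_def algebra_simps power2_eq_square)
  have "h a b = 0" "h a c = 0" "h a d = 0"
    using h[of a b] h[of a c] h[of a d] assms by auto
  hence "h2 a b c = 0" "h2 a b d = 0"
    using h2[of a b c] h2[of a b d] assms by auto
  thus ?thesis using h3[of a b c d] assms by auto
qed

lemma wg_quartic_roots:
  assumes y: "-2 \<le> y" "y \<le> 2"
  obtains g d where "0 < g" "g < 2" "2 < d"
    "wg_alpha y < -1" "-1 < wg_beta y" "wg_beta y \<le> 0"
    "{x. wg_quartic y x = 0} = {wg_alpha y, wg_beta y, g, d}"
    "wg_alpha y + wg_beta y + g + d = 1"
proof -
  have cont: "continuous_on S (wg_quartic y)" for S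
    unfolding wg_quartic_def by (intro continuous_intros)
  \<comment> \<open>Sign changes isolate the four roots. The value at 0 is \<open>4 + 2 * y\<close>,
    which vanishes for \<open>y = -2\<close>; the point 1/5 therefore keeps the third root strictly
    positive.\<close>
  have v: "wg_quartic y (-3) > 0" "wg_quartic y (-1) < 0" "wg_quartic y 0 \<ge> 0"
    "wg_quartic y (1/5) > 0" "wg_quartic y 2 < 0" "wg_quartic y 3 > 0"
    using y by (auto simp: wg_quartic_def power2_eq_square field_simps)
  obtain a where "-3 \<le> a" "a \<le> -1" "wg_quartic y a = 0"
    using IVT2'[OF _ _ _ cont, of "-1" 0 "-3"] v by auto
  moreover obtain b where "-1 \<le> b" "b \<le> 0" "wg_quartic y b = 0"
    using IVT'[OF _ _ _ cont, of "-1" 0 "0"] v by auto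
  moreover obtain g where "1/5 \<le> g" "g \<le> 2" "wg_quartic y g = 0"
    using IVT2'[OF _ _ _ cont, of "2" 0 "1/5"] v by auto
  moreover obtain d where "2 \<le> d" "d \<le> 3" "wg_quartic y d = 0"
    using IVT'[OF _ _ _ cont, of "2" 0 "3"] v by auto
  moreover have ne: "x \<noteq> -1" "x \<noteq> 2" if "wg_quartic y x = 0" for x
    using that v by auto
  ultimately have r: "wg_quartic y a = 0" "wg_quartic y b = 0" "wg_quartic y g = 0" "wg_quartic y d = 0"
    and o: "a < -1" "-1 < b" "b \<le> 0" "0 < g" "g < 2" "2 < d"
    by (auto simp: less_le)
  have sum: "a + b + g + d = 1"
    using wg_quartic_roots_sum[OF r] o by auto
  \<comment> \<open>A further root could replace \<open>d\<close> in the root sum, which forces it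
    to equal \<open>d\<close>.\<close>
  have uniq: "x \<in> {a, b, g, d}" if "wg_quartic y x = 0" for x
  proof (rule ccontr)
    assume "x \<notin> {a, b, g, d}"
    hence "a + b + g + x = 1" using wg_quartic_roots_sum[OF r(1-3) that] o by auto
    with sum \<open>x \<notin> {a, b, g, d}\<close> show False by auto
  qed
  have "wg_alpha y = a" unfolding wg_alpha_def
  proof (rule the_equality)
    show "a \<in> {..<-1} \<and> wg_F a = y" using o r by (simp add: wg_F_eq_iff)
    show "x = a" if "x \<in> {..<-1} \<and> wg_F x = y" for x
      using uniq[of x] wg_F_eq_iff[of x y] that o by auto
  qed
  moreover have "wg_beta y = b" unfolding wg_beta_def
  proof (rule the_equality)
    show "b \<in> {-1<..0} \<and> wg_F b = y" using o r by (simp add: wg_F_eq_iff)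
    show "x = b" if "x \<in> {-1<..0} \<and> wg_F x = y" for x
      using uniq[of x] wg_F_eq_iff[of x y] that o by auto
  qed
  moreover have "{x. wg_quartic y x = 0} = {a, b, g, d}" using uniq r by auto
  ultimately show ?thesis using o sum that by simp
qed

section \<open>Eigenvectors of the wine glass cycle\<close>

text \<open>
  At \<open>x = 0\<close>, which occurs only for \<open>w = -1\<close>, the generic formula degenerates (its \<open>Vp\<close>-entry
  becomes 0/0) and the eigenvector is supported on the \<open>Vp\<close>-vertices.
  At \<open>x = -1\<close> it is the antisymmetric vector on the edges between \<open>Vs\<close> and \<open>Vt\<close>.
\<close>

fun wg_mode :: "complex \<Rightarrow> real \<Rightarrow> wg_vertex \<Rightarrow> complex" where
  "wg_mode w x (Vp l) =
     (if x = 0 then 1 else (1 + cnj w) * of_real ((x + 1) * (x - 2) / x)) * w ^ l"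
| "wg_mode w x (Vq l) = (if x = 0 then 0 else of_real ((x + 1) * (x - 2))) * w ^ l"
| "wg_mode w x (Vr l) = (if x = 0 \<or> x = -1 then 0 else of_real (x - 1)) * w ^ l"
| "wg_mode w x (Vs l) = (if x = 0 then 0 else 1) * w ^ l"
| "wg_mode w x (Vt l) = (if x = 0 then 0 else if x = -1 then -1 else 1) * w ^ l"

lemma pverts_wine_glass_cycle:
  "pverts (wine_glass_cycle k) = (\<Union>j<k. {Vp j, Vq j, Vr j, Vs j, Vt j})"
  by (simp add: wine_glass_cycle_def)

lemma sum_pverts_wine_glass_cycle:
  "(\<Sum>v\<in>pverts (wine_glass_cycle k). h v)
     = (\<Sum>l<k. h (Vp l) + h (Vq l) + h (Vr l) + h (Vs l) + h (Vt l))"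
  unfolding pverts_wine_glass_cycle
  by (subst sum.UNION_disjoint) (auto simp: add.assoc)

lemma card_pverts_wine_glass_cycle: "card (pverts (wine_glass_cycle k)) = 5 * k"
  using sum_pverts_wine_glass_cycle[of "\<lambda>_. 1 :: nat" k] by simp

text \<open>The inverse of \<open>(l + 1) mod k\<close> on the indices; the case split avoids
  truncated subtraction at 0.\<close>

definition cyc_pred :: "nat \<Rightarrow> nat \<Rightarrow> nat" where
  "cyc_pred k l = (if l = 0 then k - 1 else l - 1)"

lemma neighbours_wine_glass_cycle:
  assumes "l < k"
  shows "{y. (Vp l, y) \<in> parcs (wine_glass_cycle k)} = {Vq l, Vq (cyc_pred k l)}"
    and "{y. (Vq l, y) \<in> parcs (wine_glass_cycle k)} = {Vp l, Vp ((l + 1) mod k), Vr l}"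
    and "{y. (Vr l, y) \<in> parcs (wine_glass_cycle k)} = {Vq l, Vs l, Vt l}"
    and "{y. (Vs l, y) \<in> parcs (wine_glass_cycle k)} = {Vr l, Vt l}"
    and "{y. (Vt l, y) \<in> parcs (wine_glass_cycle k)} = {Vr l, Vs l}"
proof -
  have "l = (j + 1) mod k \<longleftrightarrow> j = cyc_pred k l" if "j < k" for j
    using that assms by (auto simp: cyc_pred_def mod_Suc)
  moreover have "cyc_pred k l < k" using assms by (auto simp: cyc_pred_def)
  ultimately show "{y. (Vp l, y) \<in> parcs (wine_glass_cycle k)} = {Vq l, Vq (cyc_pred k l)}"
    using assms by (auto simp: wine_glass_cycle_def parcs_mk_symmetric)
qed (use assms in \<open>auto simp: wine_glass_cycle_def parcs_mk_symmetric\<close>)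

text \<open>In the generic case the entries are chosen so that the equations at \<open>Vp\<close>,
  \<open>Vr\<close>, \<open>Vs\<close> and \<open>Vt\<close> hold identically in \<open>x\<close>;
  the one at \<open>Vq\<close> is the quartic.\<close>

lemma wg_mode_eigen:
  assumes k: "k \<ge> 2" and wk: "w ^ k = 1" and w1: "cmod w = 1"
    and x: "x = -1 \<or> wg_quartic (2 * Re w) x = 0"
    and v: "v \<in> pverts (wine_glass_cycle k)"
  shows "(\<Sum>y | (v, y) \<in> parcs (wine_glass_cycle k). wg_mode w x y) = of_real x * wg_mode w x v"
proof -
  obtain l where l: "l < k" and v: "v \<in> {Vp l, Vq l, Vr l, Vs l, Vt l}"
    using v by (auto simp: pverts_wine_glass_cycle)
  have ww: "w * cnj w = 1" using w1 by (simp add: complex_norm_square[symmetric])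
  have w_add: "w + cnj w = of_real (2 * Re w)" by (rule complex_add_cnj)
  \<comment> \<open>The wrap-around at the ends of the index range respects the phase because
    \<open>w ^ k = 1\<close>.\<close>
  have succ: "w ^ ((l + 1) mod k) = w * w ^ l"
    using l wk by (auto simp: mod_Suc)
  have pred: "w ^ cyc_pred k l = cnj w * w ^ l"
  proof -
    have "w * w ^ cyc_pred k l = w ^ l"
      using k wk by (cases l) (auto simp: cyc_pred_def power_Suc[symmetric] simp del: power_Suc)
    hence "cnj w * w ^ l = (w * cnj w) * w ^ cyc_pred k l" by (metis mult.assoc mult.commute)
    thus ?thesis by (simp add: ww)
  qed
  \<comment> \<open>Neighbourhoods are sets, so both cycle neighbours contribute only if they are
    distinct; this is where \<open>k \<ge> 2\<close> enters.\<close>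
  have ne: "l \<noteq> cyc_pred k l" "(l + 1) mod k \<noteq> l"
    using k l by (auto simp: cyc_pred_def mod_Suc)
  show ?thesis
  proof (cases "x = 0")
    case True
    hence "Re w = -1" using x by (auto simp: wg_quartic_def)
    \<comment> \<open>Now the two \<open>Vp\<close>-neighbours of each \<open>Vq l\<close> carry
      opposite values and cancel.\<close>
    hence "w = -1" using w1 by (auto simp: complex_eq_iff cmod_def)
    with True v l ne succ show ?thesis
      by (auto simp: neighbours_wine_glass_cycle)
  next
    case x0: False
    show ?thesis
    proof (cases "x = -1")
      case True
      with v l ne show ?thesis by (auto simp: neighbours_wine_glass_cycle)
    next
      case False
      let ?Q = "(x + 1) * (x - 2)"
      have quart: "(x\<^sup>2 - 3 - 2 * Re w) * ?Q = 2"
        using x False by (simp add: wg_quartic_def)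
      \<comment> \<open>The equation at \<open>Vq\<close>, obtained from \<open>quart\<close>
        through \<open>?Q + 2 = x * (x - 1)\<close>.\<close>
      have r: "x * ?Q = (2 + 2 * Re w) * (?Q / x) + (x - 1)"
      proof -
        have "x * (x * ?Q) = (2 + 2 * Re w) * ?Q + x * (x - 1)"
          using quart by (simp add: algebra_simps power2_eq_square)
        thus ?thesis using x0 by (simp add: field_simps)
      qed
      have "(1 + w) * (1 + cnj w) = 1 + (w + cnj w) + w * cnj w" by (simp add: algebra_simps)
      also have "\<dots> = of_real (2 + 2 * Re w)" unfolding ww w_add by simp
      finally have "(1 + w) * (1 + cnj w) * of_real (?Q / x) + of_real (x - 1)
          = complex_of_real ((2 + 2 * Re w) * (?Q / x) + (x - 1))"
        by (simp only: of_real_mult of_real_add)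
      hence q: "(1 + w) * (1 + cnj w) * of_real (?Q / x) + of_real (x - 1) = complex_of_real (x * ?Q)"
        by (simp only: r)
      from v consider "v = Vp l" | "v = Vq l" | "v = Vr l" | "v = Vs l" | "v = Vt l" by auto
      then show ?thesis
      proof cases
        case 1
        have "(\<Sum>y | (v, y) \<in> parcs (wine_glass_cycle k). wg_mode w x y)
            = (1 + cnj w) * of_real ?Q * w ^ l"
          using 1 l ne x0 by (simp add: neighbours_wine_glass_cycle pred algebra_simps)
        also have "?Q = x * (?Q / x)" using x0 by simp
        also have "(1 + cnj w) * of_real (x * (?Q / x)) * w ^ l = of_real x * wg_mode w x v"
          unfolding of_real_mult[of x] using 1 x0 by (simp add: mult_ac)
        finally show ?thesis .
      next
        case 2
        have "(\<Sum>y | (v, y) \<in> parcs (wine_glass_cycle k). wg_mode w x y)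
            = ((1 + w) * (1 + cnj w) * of_real (?Q / x) + of_real (x - 1)) * w ^ l"
          using 2 l ne x0 False succ
          by (simp add: neighbours_wine_glass_cycle del: of_real_divide of_real_mult)
             (simp add: algebra_simps add_divide_distrib diff_divide_distrib)
        also have "\<dots> = of_real x * wg_mode w x v"
          unfolding q using 2 x0 by simp
        finally show ?thesis .
      next
        case 3
        then show ?thesis using l ne x0 False
          by (simp add: neighbours_wine_glass_cycle algebra_simps)
      next
        case 4
        then show ?thesis using l ne x0 False
          by (simp add: neighbours_wine_glass_cycle algebra_simps)
      next
        case 5
        then show ?thesis using l ne x0 False
          by (simp add: neighbours_wine_glass_cycle algebra_simps)
      qed
    qed
  qed
qed

text \<open>The inner product is a constant times the geometric sum of \<open>cnj w * z\<close>, a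
  \<open>k\<close>-th root of unity other than 1. A common \<open>x\<close> suffices, as modes with
  different eigenvalues are orthogonal by symmetry.\<close>

lemma wg_mode_orthogonal:
  assumes w: "w ^ k = 1" "cmod w = 1" and z: "z ^ k = 1" "cmod z = 1" and "w \<noteq> z"
  shows "(\<Sum>v\<in>pverts (wine_glass_cycle k). cnj (wg_mode w x v) * wg_mode z x v) = 0"
proof -
  let ?u = "cnj w * z"
  have ww: "w * cnj w = 1" using w by (simp add: complex_norm_square[symmetric])
  have "?u \<noteq> 1"
  proof
    assume "?u = 1"
    hence "w = w * (cnj w * z)" by simp
    also have "\<dots> = z" using ww by (simp add: mult.assoc[symmetric])
    finally show False using \<open>w \<noteq> z\<close> by simp
  qed
  moreover have "?u ^ k = 1"
    using w z by (simp add: power_mult_distrib complex_cnj_power[symmetric] del: complex_cnj_power)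
  ultimately have geo: "(\<Sum>l<k. ?u ^ l) = 0"
    by (simp add: geometric_sum)
  define C where "C = cnj (wg_mode w x (Vp 0)) * wg_mode z x (Vp 0)
    + cnj (wg_mode w x (Vq 0)) * wg_mode z x (Vq 0) + cnj (wg_mode w x (Vr 0)) * wg_mode z x (Vr 0)
    + cnj (wg_mode w x (Vs 0)) * wg_mode z x (Vs 0) + cnj (wg_mode w x (Vt 0)) * wg_mode z x (Vt 0)"
  have "(\<Sum>v\<in>pverts (wine_glass_cycle k). cnj (wg_mode w x v) * wg_mode z x v) = (\<Sum>l<k. C * ?u ^ l)"
    unfolding sum_pverts_wine_glass_cycle C_def
    by (intro sum.cong refl) (simp add: power_mult_distrib algebra_simps)
  also have "\<dots> = 0" using geo by (simp add: sum_distrib_left[symmetric])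
  finally show ?thesis .
qed

lemma wg_mode_nonzero:
  assumes "k > 0"
  shows "\<exists>v\<in>pverts (wine_glass_cycle k). wg_mode w x v \<noteq> 0"
proof (cases "x = 0")
  case True
  with assms show ?thesis by (intro bexI[of _ "Vp 0"]) (auto simp: pverts_wine_glass_cycle)
next
  case False
  with assms show ?thesis by (intro bexI[of _ "Vs 0"]) (auto simp: pverts_wine_glass_cycle)
qed

section \<open>Summation over the roots of unity\<close>

theorem theorem3:
  fixes k :: nat
  assumes "k \<ge> 2"
  shows "graph_energy (wine_glass_cycle k) =
           2 * real k
           - 2 * (\<Sum>j = 0..k - 1. wg_alpha (2 * cos (2 * real j * pi / real k)))
           - 2 * (\<Sum>j = 0..k - 1. wg_beta (2 * cos (2 * real j * pi / real k)))"
proof -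
  define w where "w j = cis (2 * real j * pi / real k)" for j
  define y where "y j = 2 * cos (2 * real j * pi / real k)" for j
  \<comment> \<open>The spectrum belonging to \<open>w j\<close>: -1 is not a root of the quartic,
    so there are five distinct values.\<close>
  define S where "S j = insert (-1) {x. wg_quartic (y j) x = 0}" for j
  have wk: "w j ^ k = 1" for j
    using assms cis_multiple_2pi[of "real j"] by (simp add: w_def DeMoivre mult_ac)
  have w1: "cmod (w j) = 1" for j by (simp add: w_def)
  have yRe: "y j = 2 * Re (w j)" for j by (simp add: y_def w_def)
  have inj: "inj_on w {..<k}"
    using bij_betw_roots_unity[of k] assms
    by (auto simp: bij_betw_def w_def[abs_def] mult_ac)
  have S: "card (S j) = 5 \<and> (\<Sum>x\<in>S j. \<bar>x\<bar>) = 2 - 2 * wg_alpha (y j) - 2 * wg_beta (y j)" for j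
  proof -
    have "-2 \<le> y j" "y j \<le> 2" by (auto simp: y_def)
    then obtain g d where "0 < g" "g < 2" "2 < d"
      "wg_alpha (y j) < -1" "-1 < wg_beta (y j)" "wg_beta (y j) \<le> 0"
      "{x. wg_quartic (y j) x = 0} = {wg_alpha (y j), wg_beta (y j), g, d}"
      "wg_alpha (y j) + wg_beta (y j) + g + d = 1"
      by (rule wg_quartic_roots)
    thus ?thesis by (auto simp: S_def)
  qed
  have fin: "finite (S j)" for j using S[of j] by (auto intro: card_ge_0_finite)
  let ?I = "Sigma {..<k} S"
  have "graph_energy (wine_glass_cycle k) = (\<Sum>c\<in>?I. \<bar>snd c\<bar>)"
  proof (rule graph_energy_eigenbasis[where f = "\<lambda>c. wg_mode (w (fst c)) (snd c)"])
    show "pair_graph (wine_glass_cycle k)" by (rule pair_graph_wine_glass_cycle)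
    show "finite ?I" using fin by auto
    show "card ?I = card (pverts (wine_glass_cycle k))"
      using S fin by (simp add: card_pverts_wine_glass_cycle card_SigmaI)
    show "(\<Sum>u | (v, u) \<in> parcs (wine_glass_cycle k). wg_mode (w (fst c)) (snd c) u)
        = of_real (snd c) * wg_mode (w (fst c)) (snd c) v"
      if "c \<in> ?I" "v \<in> pverts (wine_glass_cycle k)" for c v
      using that by (intro wg_mode_eigen[OF assms wk w1]) (auto simp: S_def yRe)
    show "\<exists>v\<in>pverts (wine_glass_cycle k). wg_mode (w (fst c)) (snd c) v \<noteq> 0" for c
      using assms by (intro wg_mode_nonzero) auto
    show "(\<Sum>v\<in>pverts (wine_glass_cycle k).
        cnj (wg_mode (w (fst c)) (snd c) v) * wg_mode (w (fst d)) (snd d) v) = 0"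
      if "c \<in> ?I" "d \<in> ?I" "c \<noteq> d" "snd c = snd d" for c d
    proof -
      \<comment> \<open>Distinct pairs with the same eigenvalue differ in the index
        \<open>j\<close>, hence in the root of unity.\<close>
      have "w (fst c) \<noteq> w (fst d)"
        using that inj by (auto simp: inj_on_eq_iff)
      thus ?thesis using that(4) by (simp add: wg_mode_orthogonal[OF wk w1 wk w1])
    qed
  qed
  also have "\<dots> = (\<Sum>j<k. \<Sum>x\<in>S j. \<bar>x\<bar>)"
    using fin by (subst sum.Sigma) (auto simp: case_prod_beta)
  also have "\<dots> = 2 * real k - 2 * (\<Sum>j<k. wg_alpha (y j)) - 2 * (\<Sum>j<k. wg_beta (y j))"
    using S by (simp add: sum_subtractf sum_distrib_left)
  also have "{..<k} = {0..k - 1}" using assms by auto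
  finally show ?thesis unfolding y_def .
qed

end
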